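(* For each integer $m\geq 0$ the following three identities hold, where $F_k$ denotes the $k$-th Fibonacci number: $$\frac{\pi}{12} = \sqrt{5}\sum_{n=0}^\infty \frac{(-1)^n}{2n+1} F_{(2m+1)(2n+1)} \Big (\frac{2(2-\sqrt{3})}{\sqrt{5}F_{2m+1} + \sqrt{5F_{2m+1}^2+4(2-\sqrt{3})^2}}\Big )^{2n+1},$$ $$\frac{\pi}{6} = \sqrt{5}\sum_{n=0}^\infty \frac{(-1)^n}{2n+1} F_{(2m+1)(2n+1)} \Big (\frac{2}{\sqrt{15}F_{2m+1} + \sqrt{15F_{2m+1}^2+4}}\Big )^{2n+1},$$ and $$\frac{\pi}{5} = \sqrt{5}\sum_{n=0}^\infty \frac{(-1)^n}{2n+1} F_{(2m+1)(2n+1)} \Big (\frac{2\sqrt{5-2\sqrt{5}}}{\sqrt{5}F_{2m+1} + \sqrt{5F_{2m+1}^2+4(5-2\sqrt{5})}}\Big )^{2n+1}.$$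
   Context: The Fibonacci numbers are defined by $F_0=0$, $F_1=1$, and $F_{n+2}=F_{n+1}+F_n$ for $n\ge 0$. *)

theory Defs
  imports Complex_Main "HOL-Number_Theory.Fib"
begin

definition fib_term :: "nat \<Rightarrow> real \<Rightarrow> nat \<Rightarrow> real" where
  "fib_term m x n =
     (-1) ^ n / real (2 * n + 1) * real (fib ((2 * m + 1) * (2 * n + 1))) * x ^ (2 * n + 1)"

text \<open>Since \<^term>\<open>suminf\<close> is total, convergence of the series is asserted explicitly.\<close>

definition series_identity :: "real \<Rightarrow> nat \<Rightarrow> real \<Rightarrow> bool" where
  "series_identity c m x \<longleftrightarrow>
     summable (fib_term m x) \<and> c = sqrt 5 * (\<Sum>n. fib_term m x n)"

end

theory Submission
  imports Defs
begin

text \<open>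
  Put \<open>a = \<phi> ^ (2 m + 1)\<close> with \<open>\<phi>\<close> the golden ratio, so that by Binet's formula
  \<open>sqrt 5 * F((2 m + 1) (2 n + 1)) = a ^ (2 n + 1) + (1 / a) ^ (2 n + 1)\<close>.
  The series is therefore a sum of two arctangent series, with value
  \<open>arctan (a x) + arctan (x / a) = arctan (sqrt 5 * F(2 m + 1) * x / (1 - x\<^sup>2))\<close>.
  The given arguments \<open>x\<close> are the positive roots of \<open>t (1 - x\<^sup>2) = sqrt 5 * F(2 m + 1) * x\<close>
  for \<open>t = tan (\<pi> / 12), tan (\<pi> / 6), tan (\<pi> / 5)\<close>, and \<open>0 < t \<le> 1\<close> already forces \<open>a x < 1\<close>.
\<close>

lemma arctan_sums:
  fixes x :: real
  assumes "\<bar>x\<bar> \<le> 1"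
  shows "(\<lambda>n. (-1) ^ n / real (2 * n + 1) * x ^ (2 * n + 1)) sums arctan x"
  using summable_sums[OF summable_arctan_series[OF assms]] arctan_series[OF assms]
  by (simp add: mult.commute)

text \<open>The conjugate root \<open>(1 - sqrt 5) / 2\<close> is minus the reciprocal of the golden
  ratio, so an odd exponent turns the difference in Binet's formula into a sum.\<close>

lemma fib_odd_closed_form:
  assumes "odd k"
  shows "sqrt 5 * real (fib k) = ((1 + sqrt 5) / 2) ^ k + (1 / ((1 + sqrt 5) / 2)) ^ k"
proof -
  have "1 + sqrt 5 \<noteq> 0"
    using real_sqrt_ge_zero[of 5] by linarith
  then have "(1 - sqrt 5) / 2 = - (1 / ((1 + sqrt 5) / 2))"
    by (simp add: field_simps)
  then have "((1 - sqrt 5) / 2) ^ k = - ((1 / ((1 + sqrt 5) / 2)) ^ k)"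
    using power_minus_odd[OF assms] by metis
  then show ?thesis
    using fib_closed_form[of k] by simp
qed

text \<open>The quadratic formula for \<open>t * x\<^sup>2 + s * x - t = 0\<close> gives
  \<open>(r - s) / (2 * t)\<close> with \<open>r = sqrt (s\<^sup>2 + 4 * t\<^sup>2)\<close>;
  \<open>x\<close> is this root with its numerator rationalised.\<close>

lemma positive_root_eq:
  fixes s t :: real
  assumes "0 < s" "0 < t"
  defines "x \<equiv> 2 * t / (s + sqrt (s\<^sup>2 + 4 * t\<^sup>2))"
  shows "0 < x" "s * x = t * (1 - x\<^sup>2)"
proof -
  define r where "r = sqrt (s\<^sup>2 + 4 * t\<^sup>2)"
  have r: "0 \<le> r" "r\<^sup>2 = s\<^sup>2 + 4 * t\<^sup>2"
    by (simp_all add: r_def)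
  have x: "x = 2 * t / (s + r)" and pos: "0 < s + r"
    using assms(1) r(1) by (simp_all only: x_def r_def add_pos_nonneg)
  show "0 < x"
    using pos assms(2) by (simp add: x)
  have "s * (2 * t) * (s + r) = t * ((s + r)\<^sup>2 - (2 * t)\<^sup>2)"
    using r(2) by algebra
  moreover have "s * x = s * (2 * t) * (s + r) / (s + r)\<^sup>2"
    using pos by (simp add: x power2_eq_square)
  moreover have "1 - x\<^sup>2 = ((s + r)\<^sup>2 - (2 * t)\<^sup>2) / (s + r)\<^sup>2"
    using pos by (simp add: x power_divide diff_divide_distrib)
  ultimately show "s * x = t * (1 - x\<^sup>2)"
    by simp
qed

lemma series_identity_arctan:
  fixes x t :: real
  assumes t: "0 < t" "t \<le> 1" and x: "0 < x"
    and eq: "sqrt 5 * real (fib (2 * m + 1)) * x = t * (1 - x\<^sup>2)"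
  shows "series_identity (arctan t) m x"
proof -
  define \<phi> :: real where "\<phi> = (1 + sqrt 5) / 2"
  define a where "a = \<phi> ^ (2 * m + 1)"
  have "1 < sqrt 5" by simp
  then have \<phi>: "1 < \<phi>" by (simp add: \<phi>_def)
  then have a: "1 < a" unfolding a_def by (intro one_less_power) auto
  have fib: "sqrt 5 * real (fib ((2 * m + 1) * k)) = a ^ k + (1 / a) ^ k" if "odd k" for k
    using fib_odd_closed_form[of "(2 * m + 1) * k"] that
    unfolding a_def \<phi>_def[symmetric] power_one_over power_mult by simp
  have sum: "(a + 1 / a) * x = t * (1 - x\<^sup>2)"
    using eq fib[of 1] by simp
  \<comment> \<open>Dropping these two positive terms from the root equation leaves
    \<open>a * x < t\<close>, which puts both arguments inside the range of the arctangent series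
    and of the addition formula.\<close>
  have "0 < x / a" "0 < t * x\<^sup>2"
    using a x t by simp_all
  moreover have "a * x + x / a = t - t * x\<^sup>2"
    using sum by (simp add: algebra_simps)
  ultimately have ax: "a * x < 1"
    using t by linarith
  have "x / a < a * x"
    using a x by (simp add: field_simps) (metis less_1_mult mult.commute)
  then have xa: "x / a < 1"
    using ax by linarith
  have "x < a * x"
    using a x by simp
  then have "x < 1"
    using ax by linarith
  then have "1 - x\<^sup>2 > 0"
    using x by (simp add: abs_square_less_1)
  have "arctan (a * x) + arctan (x / a) = arctan ((a * x + x / a) / (1 - a * x * (x / a)))"
    using a x ax xa by (intro arctan_add) simp_all
  also have "(a * x + x / a) / (1 - a * x * (x / a)) = (a + 1 / a) * x / (1 - x\<^sup>2)"
    using a by (simp add: distrib_right power2_eq_square)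
  also have "\<dots> = t"
    using sum \<open>1 - x\<^sup>2 > 0\<close> by simp
  finally have val: "arctan (a * x) + arctan (x / a) = arctan t" .
  have "(\<lambda>n. (-1) ^ n / real (2 * n + 1) * (a * x) ^ (2 * n + 1)
           + (-1) ^ n / real (2 * n + 1) * (x / a) ^ (2 * n + 1))
        sums (arctan (a * x) + arctan (x / a))"
    using a x ax xa by (intro sums_add arctan_sums) simp_all
  moreover have "(-1) ^ n / real (2 * n + 1) * (a * x) ^ (2 * n + 1)
        + (-1) ^ n / real (2 * n + 1) * (x / a) ^ (2 * n + 1)
      = sqrt 5 * fib_term m x n" for n
  proof -
    have "(a * x) ^ (2 * n + 1) + (x / a) ^ (2 * n + 1)
        = (a ^ (2 * n + 1) + (1 / a) ^ (2 * n + 1)) * x ^ (2 * n + 1)"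
      by (simp only: power_mult_distrib power_divide power_one distrib_right) simp
    also have "\<dots> = sqrt 5 * real (fib ((2 * m + 1) * (2 * n + 1))) * x ^ (2 * n + 1)"
      by (subst fib) simp_all
    finally show ?thesis
      unfolding fib_term_def distrib_left[symmetric] by (simp only: mult_ac)
  qed
  ultimately have sums: "(\<lambda>n. sqrt 5 * fib_term m x n) sums arctan t"
    by (simp only: val)
  \<comment> \<open>Convergence passes back through the nonzero factor
    \<open>sqrt 5\<close>.\<close>
  then have "summable (fib_term m x)"
    using sums_summable summable_cmult_iff[of "sqrt 5"] by fastforce
  with sums show ?thesis
    unfolding series_identity_def by (simp add: sums_iff suminf_mult)
qed

lemma series_identity_positive_root:
  fixes t :: real
  assumes "0 < t" "t \<le> 1"
  shows "series_identity (arctan t) m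
    (2 * t / (sqrt 5 * real (fib (2 * m + 1))
              + sqrt (5 * (real (fib (2 * m + 1)))\<^sup>2 + 4 * t\<^sup>2)))"
proof -
  have "0 < sqrt 5 * real (fib (2 * m + 1))"
    by (simp add: fib_neq_0_nat)
  from positive_root_eq[OF this assms(1)] show ?thesis
    by (intro series_identity_arctan) (use assms in \<open>simp_all add: power_mult_distrib\<close>)
qed

lemma sqrt_3_bounds: "3 / 2 < sqrt 3" "sqrt 3 < 2"
  by (rule real_less_rsqrt real_less_lsqrt; simp add: power2_eq_square)+

text \<open>The upper bound makes \<open>5 - 2 * sqrt 5\<close> positive and the lower one makes it
  less than 1, so its square root is an admissible \<open>t\<close>.\<close>

lemma sqrt_5_bounds: "2 < sqrt 5" "sqrt 5 < 5 / 2"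
  by (rule real_less_rsqrt real_less_lsqrt; simp add: power2_eq_square)+

lemma arctan_pi_6: "arctan (1 / sqrt 3) = pi / 6"
  by (rule arctan_unique) (simp_all add: tan_30)

lemma arctan_pi_12: "arctan (2 - sqrt 3) = pi / 12"
proof -
  \<comment> \<open>The denominator is \<open>4 * sqrt 3 - 6 = 2 * sqrt 3 * (2 - sqrt 3)\<close>.
    Doubling the angle thus leads to \<pi>/6.\<close>
  have "2 * (2 - sqrt 3) / (1 - (2 - sqrt 3)\<^sup>2) = 1 / sqrt 3"
    using sqrt_3_bounds by (simp add: field_simps power2_eq_square)
  then show ?thesis
    using arctan_double[of "2 - sqrt 3"] sqrt_3_bounds by (simp add: arctan_pi_6)
qed

text \<open>
  With \<open>v = 1 / tan (2 \<pi> / 5)\<close> one has \<open>2 arctan v = arctan t\<close> and \<open>2 arctan t = \<pi> / 2 - arctan v\<close>.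
\<close>
lemma arctan_pi_5: "arctan (sqrt (5 - 2 * sqrt 5)) = pi / 5"
proof -
  define t where "t = sqrt (5 - 2 * sqrt 5)"
  define v where "v = (sqrt 5 - 2) / t"
  have s5: "2 < sqrt 5" "sqrt 5 < 5 / 2" "(sqrt 5)\<^sup>2 = 5"
    using sqrt_5_bounds by simp_all
  have t: "0 < t" "t\<^sup>2 = 5 - 2 * sqrt 5"
    using s5 by (simp_all add: t_def)
  have "t\<^sup>2 < 1"
    using s5 t by simp
  then have "t < 1"
    by (simp add: abs_square_less_1 t(1))
  have v: "0 < v"
    using s5 t by (simp add: v_def)
  \<comment> \<open>In this form \<open>1 - v\<^sup>2\<close> is visibly \<open>2 * v / t\<close>,
    as the double-angle formula needs; it also yields \<open>v < 1\<close>.\<close>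
  have v2: "v\<^sup>2 = 1 - 2 * (sqrt 5 - 2) / t\<^sup>2"
  proof -
    have "(sqrt 5 - 2)\<^sup>2 = t\<^sup>2 - 2 * (sqrt 5 - 2)"
      using t(2) s5(3) by (simp add: power2_diff)
    then have "v\<^sup>2 = (t\<^sup>2 - 2 * (sqrt 5 - 2)) / t\<^sup>2"
      by (simp only: v_def power_divide)
    also have "\<dots> = 1 - 2 * (sqrt 5 - 2) / t\<^sup>2"
      using t(1) by (subst diff_divide_distrib) simp
    finally show ?thesis .
  qed
  have "0 < 2 * (sqrt 5 - 2) / t\<^sup>2"
    using s5 t(1) by simp
  then have "v < 1"
    using v2 v abs_square_less_1[of v] by simp
  have "2 * v / (1 - v\<^sup>2) = t"
    unfolding v2 using s5 t(1) by (simp add: v_def field_simps power2_eq_square)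
  then have "2 * arctan v = arctan t"
    using arctan_double[of v] \<open>v < 1\<close> v by simp
  \<comment> \<open>The right-hand side is \<open>2 * v * t\<close>, so doubling
    \<open>arctan t\<close> produces the reciprocal of \<open>v\<close>.\<close>
  moreover have "1 - t\<^sup>2 = 2 * (sqrt 5 - 2)"
    using t(2) by simp
  then have "2 * t / (1 - t\<^sup>2) = 1 / v"
    by (simp only: v_def mult_divide_mult_cancel_left) simp
  then have "2 * arctan t = arctan (1 / v)"
    using arctan_double[of t] \<open>t < 1\<close> t(1) by simp
  moreover have "arctan (1 / v) = pi / 2 - arctan v"
    using arctan_inverse[of v] v by simp
  \<comment> \<open>Eliminating \<open>arctan v\<close> gives
    \<open>2 * arctan t = pi / 2 - arctan t / 2\<close>.\<close>
  ultimately show ?thesis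
    unfolding t_def by simp
qed

theorem theorem6:
  fixes m :: nat
  shows "series_identity (pi / 12) m
           (2 * (2 - sqrt 3) /
             (sqrt 5 * real (fib (2 * m + 1))
              + sqrt (5 * (real (fib (2 * m + 1)))\<^sup>2 + 4 * (2 - sqrt 3)\<^sup>2)))
       \<and> series_identity (pi / 6) m
           (2 /
             (sqrt 15 * real (fib (2 * m + 1))
              + sqrt (15 * (real (fib (2 * m + 1)))\<^sup>2 + 4)))
       \<and> series_identity (pi / 5) m
           (2 * sqrt (5 - 2 * sqrt 5) /
             (sqrt 5 * real (fib (2 * m + 1))
              + sqrt (5 * (real (fib (2 * m + 1)))\<^sup>2 + 4 * (5 - 2 * sqrt 5))))"
proof (intro conjI)
  let ?F = "real (fib (2 * m + 1))"
  show "series_identity (pi / 12) m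
      (2 * (2 - sqrt 3) / (sqrt 5 * ?F + sqrt (5 * ?F\<^sup>2 + 4 * (2 - sqrt 3)\<^sup>2)))"
    using series_identity_positive_root[of "2 - sqrt 3" m] sqrt_3_bounds by (simp add: arctan_pi_12)
  \<comment> \<open>The second identity is the case \<open>t = 1 / sqrt 3\<close> with numerator and
    denominator multiplied by \<open>sqrt 3\<close>.\<close>
  have "sqrt 15 * ?F + sqrt (15 * ?F\<^sup>2 + 4)
      = sqrt 3 * (sqrt 5 * ?F + sqrt (5 * ?F\<^sup>2 + 4 * (1 / sqrt 3)\<^sup>2))"
    by (simp add: distrib_left power_divide flip: real_sqrt_mult mult.assoc)
  then have "2 / (sqrt 15 * ?F + sqrt (15 * ?F\<^sup>2 + 4))
      = 2 * (1 / sqrt 3) / (sqrt 5 * ?F + sqrt (5 * ?F\<^sup>2 + 4 * (1 / sqrt 3)\<^sup>2))"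
    by simp
  then show "series_identity (pi / 6) m (2 / (sqrt 15 * ?F + sqrt (15 * ?F\<^sup>2 + 4)))"
    using series_identity_positive_root[of "1 / sqrt 3" m] sqrt_3_bounds by (simp only: arctan_pi_6) simp
  show "series_identity (pi / 5) m (2 * sqrt (5 - 2 * sqrt 5)
      / (sqrt 5 * ?F + sqrt (5 * ?F\<^sup>2 + 4 * (5 - 2 * sqrt 5))))"
    using series_identity_positive_root[of "sqrt (5 - 2 * sqrt 5)" m] sqrt_5_bounds by (simp add: arctan_pi_5)
qed

end
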